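(* Let $n\geq 3$ be an odd number, let $\sigma=(0,1,\dots,n-1)$ and let $L=L(\langle\sigma\rangle)$ be the layer closure of $\langle\sigma\rangle$ in $\mathcal{A}_n=\mathrm{Aut}(T_n)$. Let $s$ be an integer which is relatively prime to $n$ and let $\beta=(\beta|_0,\beta|_1,\dots,\beta|_{n-1})\sigma^s\in L$ be such that $[\beta,\beta^{\tau^x}]=e$ for all $x\in\mathbb{Z}$. Then $\beta$ is a conjugate of $\tau$ in $\mathcal{A}_n$.
   Context: Let $Y=\{0,1,\dots,n-1\}$, and let $T_n$ be the regular rooted $n$-ary tree whose vertices are the finite words over $Y$ (root = empty word). $\mathcal{A}_n=\mathrm{Aut}(T_n)$. Automorphisms act on the right, $\alpha\beta$ means first $\alpha$ then $\beta$, $e$ is the identity, $a^b=b^{-1}ab$, $[a,b]=a^{-1}b^{-1}ab$. Each $\alpha\in\mathcal{A}_n$ is written $\alpha=(\alpha|_0,\dots,\alpha|_{n-1})\sigma_\alpha$, where the permutation $\sigma_\alpha$ of $Y$ (the activity of $\alpha$) and $\alpha|_i\in\mathcal{A}_n$ are determined by $(iu)\alpha=(i)\sigma_\alpha\cdot(u)\alpha|_i$ for $i\in Y$ and every word $u$. The states $\alpha|_u$ for words $u$ are obtained by iteration: $\alpha|_\emptyset=\alpha$, $\alpha|_{ui}=(\alpha|_u)|_i$. For a subgroup $P$ of the symmetric group $\Sigma_n$ on $Y$, the layer closure $L(P)$ is the group of all $\alpha\in\mathcal{A}_n$ such that $\sigma_{\alpha|_u}\in P$ for every word $u$. The $n$-ary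 adding machine is $\tau=(e,\dots,e,\tau)\sigma$, where $\sigma$ is the cycle $i\mapsto i+1\pmod n$. *)

theory Defs
  imports "HOL-Algebra.Generated_Groups" "HOL-Combinatorics.Permutations"
begin

text \<open>
  All maps act on the right, so the product of \<open>p\<close> and \<open>q\<close> is ``first \<open>p\<close>, then \<open>q\<close>''.
  As usual for \<^const>\<open>permutes\<close>, a permutation of \<open>S\<close> is a total function
  that is the identity outside \<open>S\<close>, which makes equality of functions the equality of permutations.
\<close>

definition perm_group :: "'a set \<Rightarrow> ('a \<Rightarrow> 'a) monoid" where
  "perm_group S = \<lparr>carrier = {p. p permutes S}, monoid.mult = (\<lambda>p q. q \<circ> p), one = id\<rparr>"

definition conj_by :: "('a, 'b) monoid_scheme \<Rightarrow> 'a \<Rightarrow> 'a \<Rightarrow> 'a" where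
  "conj_by G a b = inv\<^bsub>G\<^esub> b \<otimes>\<^bsub>G\<^esub> a \<otimes>\<^bsub>G\<^esub> b"

definition commutator :: "('a, 'b) monoid_scheme \<Rightarrow> 'a \<Rightarrow> 'a \<Rightarrow> 'a" where
  "commutator G a b = inv\<^bsub>G\<^esub> a \<otimes>\<^bsub>G\<^esub> inv\<^bsub>G\<^esub> b \<otimes>\<^bsub>G\<^esub> a \<otimes>\<^bsub>G\<^esub> b"

definition conjugate_in :: "('a, 'b) monoid_scheme \<Rightarrow> 'a \<Rightarrow> 'a \<Rightarrow> bool" where
  "conjugate_in G a b \<longleftrightarrow> (\<exists>g\<in>carrier G. a = conj_by G b g)"

definition words :: "nat \<Rightarrow> nat list set" where
  "words n = lists {..<n}"

definition tree_adj :: "nat list \<Rightarrow> nat list \<Rightarrow> bool" where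
  "tree_adj u v \<longleftrightarrow> (\<exists>i. v = u @ [i] \<or> u = v @ [i])"

definition tree_auts :: "nat \<Rightarrow> (nat list \<Rightarrow> nat list) set" where
  "tree_auts n = {\<alpha>. \<alpha> permutes words n \<and> \<alpha> [] = [] \<and>
     (\<forall>u\<in>words n. \<forall>v\<in>words n. tree_adj (\<alpha> u) (\<alpha> v) \<longleftrightarrow> tree_adj u v)}"

definition aut_tree :: "nat \<Rightarrow> (nat list \<Rightarrow> nat list) monoid" where
  "aut_tree n = (perm_group (words n))\<lparr>carrier := tree_auts n\<rparr>"

text \<open>
  The next two maps are the components of \<open>(iu)\<alpha> = (i)\<sigma>\<^sub>\<alpha> \<cdot> (u)\<alpha>|\<^sub>i\<close>;
  see \<open>tree_aut_Cons\<close> below. Outside \<open>words n\<close>, \<open>section_at \<alpha> i\<close> is the identity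
  for \<open>i < n\<close>, because \<open>\<alpha>\<close> is.
\<close>

definition activity :: "nat \<Rightarrow> (nat list \<Rightarrow> nat list) \<Rightarrow> nat \<Rightarrow> nat" where
  "activity n \<alpha> i = (if i < n then hd (\<alpha> [i]) else i)"

definition section_at :: "(nat list \<Rightarrow> nat list) \<Rightarrow> nat \<Rightarrow> nat list \<Rightarrow> nat list" where
  "section_at \<alpha> i u = tl (\<alpha> (i # u))"

definition state :: "(nat list \<Rightarrow> nat list) \<Rightarrow> nat list \<Rightarrow> nat list \<Rightarrow> nat list" where
  "state \<alpha> u = foldl section_at \<alpha> u"

definition layer_closure :: "nat \<Rightarrow> (nat \<Rightarrow> nat) set \<Rightarrow> (nat list \<Rightarrow> nat list) set" where
  "layer_closure n P = {\<alpha> \<in> carrier (aut_tree n). \<forall>u\<in>words n. activity n (state \<alpha> u) \<in> P}"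

definition rotation :: "nat \<Rightarrow> nat \<Rightarrow> nat" where
  "rotation n i = (if i < n then (i + 1) mod n else i)"

primrec adding_machine :: "nat \<Rightarrow> nat list \<Rightarrow> nat list" where
  "adding_machine n [] = []"
| "adding_machine n (i # u) =
     (if i # u \<in> words n
      then rotation n i # (if i = n - 1 then adding_machine n u else u)
      else i # u)"

lemma words_simps [simp]:
  "[] \<in> words n" "i # u \<in> words n \<longleftrightarrow> i < n \<and> u \<in> words n"
  "u @ v \<in> words n \<longleftrightarrow> u \<in> words n \<and> v \<in> words n"
  by (auto simp: words_def)

lemma state_simps: "state \<alpha> [] = \<alpha>" "state \<alpha> (u @ [i]) = section_at (state \<alpha> u) i"
  by (simp_all add: state_def)

lemma group_perm_group: "group (perm_group S)"
proof (rule groupI)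
  fix p assume "p \<in> carrier (perm_group S)"
  then show "\<exists>q\<in>carrier (perm_group S). q \<otimes>\<^bsub>perm_group S\<^esub> p = \<one>\<^bsub>perm_group S\<^esub>"
    by (intro bexI [of _ "inv_into UNIV p"])
      (auto simp: perm_group_def permutes_inv permutes_inv_o)
qed (auto simp: perm_group_def permutes_id o_assoc intro: permutes_compose)

lemma inv_perm_group: "p permutes S \<Longrightarrow> inv\<^bsub>perm_group S\<^esub> p = inv_into UNIV p"
  by (rule group.inv_equality [OF group_perm_group])
    (auto simp: perm_group_def permutes_inv permutes_inv_o)

lemma tree_aut_in_words: "\<alpha> \<in> tree_auts n \<Longrightarrow> \<alpha> u \<in> words n \<longleftrightarrow> u \<in> words n"
  by (simp add: tree_auts_def permutes_in_image)

lemma tree_aut_inj: "\<alpha> \<in> tree_auts n \<Longrightarrow> \<alpha> u = \<alpha> v \<longleftrightarrow> u = v"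
  by (auto simp: tree_auts_def dest: permutes_inj injD)

lemma inv_tree_aut:
  assumes "\<alpha> \<in> tree_auts n"
  shows "inv_into UNIV \<alpha> \<in> tree_auts n"
proof -
  have p: "\<alpha> permutes words n" and r: "\<alpha> [] = []"
    and adj: "\<And>u v. u \<in> words n \<Longrightarrow> v \<in> words n \<Longrightarrow> tree_adj (\<alpha> u) (\<alpha> v) = tree_adj u v"
    using assms by (auto simp: tree_auts_def)
  have q: "inv_into UNIV \<alpha> permutes words n" by (rule permutes_inv [OF p])
  have "inv_into UNIV \<alpha> [] = []" using permutes_inv_eq [OF p] r by metis
  moreover have "tree_adj (inv_into UNIV \<alpha> u) (inv_into UNIV \<alpha> v) = tree_adj u v"
    if "u \<in> words n" "v \<in> words n" for u v
    using adj [of "inv_into UNIV \<alpha> u" "inv_into UNIV \<alpha> v"] that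
    by (simp add: permutes_in_image [OF q] permutes_inverses [OF p])
  ultimately show ?thesis using q by (auto simp: tree_auts_def)
qed

lemma subgroup_tree_auts: "subgroup (tree_auts n) (perm_group (words n))"
proof (rule group.subgroupI [OF group_perm_group])
  show "tree_auts n \<subseteq> carrier (perm_group (words n))"
    by (auto simp: tree_auts_def perm_group_def)
  have "id \<in> tree_auts n" by (auto simp: tree_auts_def permutes_id)
  then show "tree_auts n \<noteq> {}" by blast
next
  fix \<alpha> assume a: "\<alpha> \<in> tree_auts n"
  then have "\<alpha> permutes words n" by (simp add: tree_auts_def)
  then show "inv\<^bsub>perm_group (words n)\<^esub> \<alpha> \<in> tree_auts n"
    using inv_tree_aut [OF a] by (simp add: inv_perm_group)
next
  fix \<alpha> \<beta> assume "\<alpha> \<in> tree_auts n" "\<beta> \<in> tree_auts n"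
  then show "\<alpha> \<otimes>\<^bsub>perm_group (words n)\<^esub> \<beta> \<in> tree_auts n"
    by (auto simp: tree_auts_def perm_group_def permutes_in_image intro: permutes_compose)
qed

lemma group_aut_tree: "group (aut_tree n)"
  unfolding aut_tree_def
  by (rule subgroup.subgroup_is_group [OF subgroup_tree_auts group_perm_group])

lemma tree_aut_snoc:
  assumes "\<alpha> \<in> tree_auts n" "u \<in> words n" "i < n"
  shows "\<exists>j<n. \<alpha> (u @ [i]) = \<alpha> u @ [j]"
  using assms(2,3)
proof (induction u arbitrary: i rule: rev_induct)
  have *: "tree_adj (\<alpha> u) (\<alpha> (u @ [i]))" if "u \<in> words n" "i < n" for u i
    using assms(1) that by (auto simp: tree_auts_def tree_adj_def)
  have w: "\<alpha> (u @ [i]) \<in> words n" if "u \<in> words n" "i < n" for u i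
    using assms(1) that by (simp add: tree_aut_in_words)
  {
    case Nil
    have "\<alpha> [] = []" using assms(1) by (simp add: tree_auts_def)
    then show ?case using * [of "[]" i] w [of "[]" i] Nil by (auto simp: tree_adj_def)
  next
    case (snoc k v)
    obtain j where j: "\<alpha> (v @ [k]) = \<alpha> v @ [j]" using snoc.IH [of k] snoc.prems by auto
    have "\<alpha> (v @ [k, i]) \<noteq> \<alpha> v" using tree_aut_inj [OF assms(1)] by simp
    then show ?case using * [of "v @ [k]" i] w [of "v @ [k]" i] snoc.prems j
      by (auto simp: tree_adj_def)
  }
qed

lemma tree_aut_singleton:
  assumes "\<alpha> \<in> tree_auts n" "i < n"
  shows "\<alpha> [i] = [activity n \<alpha> i]" "activity n \<alpha> i < n"
  using tree_aut_snoc [OF assms(1), of "[]" i] assms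
  by (auto simp: activity_def tree_auts_def)

lemma tree_aut_Cons:
  assumes "\<alpha> \<in> tree_auts n" "i < n" "u \<in> words n"
  shows "\<alpha> (i # u) = activity n \<alpha> i # section_at \<alpha> i u"
proof -
  have "\<exists>v. \<alpha> (i # u) = activity n \<alpha> i # v"
    using assms(3)
  proof (induction u rule: rev_induct)
    case Nil
    then show ?case using tree_aut_singleton [OF assms(1,2)] by simp
  next
    case (snoc k u)
    then show ?case using tree_aut_snoc [OF assms(1), of "i # u" k] assms(2) by auto
  qed
  then show ?thesis by (auto simp: section_at_def)
qed

lemma activity_permutes:
  assumes "\<alpha> \<in> tree_auts n"
  shows "activity n \<alpha> permutes {..<n}"
proof (rule bij_imp_permutes)
  have "inj_on (activity n \<alpha>) {..<n}"
  proof (rule inj_onI)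
    fix i j assume "i \<in> {..<n}" "j \<in> {..<n}" "activity n \<alpha> i = activity n \<alpha> j"
    then have "\<alpha> [i] = \<alpha> [j]" using tree_aut_singleton [OF assms] by simp
    then show "i = j" using tree_aut_inj [OF assms] by simp
  qed
  moreover have "activity n \<alpha> ` {..<n} \<subseteq> {..<n}" using tree_aut_singleton [OF assms] by auto
  ultimately show "bij_betw (activity n \<alpha>) {..<n} {..<n}"
    by (simp add: bij_betw_def endo_inj_surj)
qed (simp add: activity_def)

lemma section_tree_aut:
  assumes a: "\<alpha> \<in> tree_auts n" and i: "i < n"
  shows "section_at \<alpha> i \<in> tree_auts n"
proof -
  let ?s = "section_at \<alpha> i"
  note c = tree_aut_Cons [OF a i]
  have ?thesis if "?s permutes words n"
  proof -
    have "tree_adj (?s u) (?s v) = tree_adj u v" if "u \<in> words n" "v \<in> words n" for u v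
    proof -
      have "tree_adj (\<alpha> (i # u)) (\<alpha> (i # v)) = tree_adj (i # u) (i # v)"
        using a i that by (simp add: tree_auts_def)
      then show ?thesis using that by (simp add: c tree_adj_def)
    qed
    moreover have "?s [] = []" using tree_aut_singleton [OF a i] by (simp add: section_at_def)
    ultimately show ?thesis using that by (simp add: tree_auts_def)
  qed
  moreover have "?s permutes words n"
  proof (rule bij_imp_permutes)
    have "inj_on ?s (words n)"
    proof (rule inj_onI)
      fix u v assume "u \<in> words n" "v \<in> words n" "?s u = ?s v"
      then have "\<alpha> (i # u) = \<alpha> (i # v)" by (simp add: c)
      then show "u = v" using tree_aut_inj [OF a] by simp
    qed
    moreover have "?s u \<in> words n" if "u \<in> words n" for u
      using tree_aut_in_words [OF a, of "i # u"] c [OF that] that i by simp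
    moreover have "v \<in> ?s ` words n" if v: "v \<in> words n" for v
    proof -
      have "activity n \<alpha> i # v \<in> words n" using v tree_aut_singleton [OF a i] by simp
      then obtain w where w: "w \<in> words n" "\<alpha> w = activity n \<alpha> i # v"
      proof -
        have "\<alpha> ` words n = words n" using a by (simp add: tree_auts_def permutes_image)
        then have "activity n \<alpha> i # v \<in> \<alpha> ` words n"
          using \<open>activity n \<alpha> i # v \<in> words n\<close> by blast
        then show thesis using that by (metis imageE)
      qed
      then obtain j u where ju: "w = j # u"
        using a by (cases w) (auto simp: tree_auts_def)
      then have "activity n \<alpha> j = activity n \<alpha> i" and v': "v = section_at \<alpha> j u"
        using w tree_aut_Cons [OF a, of j u] by auto
      then have "j = i" using permutes_inj [OF activity_permutes [OF a]] by (auto dest: injD)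
      then show ?thesis using v' w ju by auto
    qed
    ultimately show "bij_betw ?s (words n) (words n)" by (auto simp: bij_betw_def)
  next
    fix u assume "u \<notin> words n"
    then have "\<alpha> (i # u) = i # u" using a by (auto simp: tree_auts_def intro: permutes_not_in)
    then show "?s u = u" by (simp add: section_at_def)
  qed
  ultimately show ?thesis by blast
qed

lemma length_adding_machine [simp]: "length (adding_machine n u) = length u"
  by (induction u) auto

lemma rotation_permutes: "rotation n permutes {..<n}"
proof (rule bij_imp_permutes)
  have "inj_on (rotation n) {..<n}"
    by (auto simp: inj_on_def rotation_def mod_Suc split: if_splits)
  moreover have "rotation n ` {..<n} \<subseteq> {..<n}" by (auto simp: rotation_def)
  ultimately show "bij_betw (rotation n) {..<n} {..<n}" by (simp add: bij_betw_def endo_inj_surj)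
qed (simp add: rotation_def)

lemma rotation_less [simp]: "rotation n i < n \<longleftrightarrow> i < n"
  by (auto simp: rotation_def)

lemma adding_machine_permutes: "adding_machine n permutes words n"
proof (rule bij_imp_permutes)
  have rinj: "rotation n i = rotation n j \<longleftrightarrow> i = j" for i j
    using permutes_inj [OF rotation_permutes] by (auto dest: injD)
  have w: "adding_machine n u \<in> words n" if "u \<in> words n" for u
    using that by (induction u) auto
  have "adding_machine n u = adding_machine n v \<Longrightarrow> u = v"
    if "u \<in> words n" "v \<in> words n" for u v
    using that
  proof (induction u arbitrary: v)
    case Nil
    then show ?case by (cases v) auto
  next
    case (Cons i u)
    then show ?case by (cases v) (auto simp: rinj split: if_splits)
  qed
  moreover have "v \<in> adding_machine n ` words n" if "v \<in> words n" for v
    using that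
  proof (induction v)
    case Nil
    then show ?case by (intro image_eqI [of _ _ "[]"]) auto
  next
    case (Cons j v)
    then obtain u where u: "v = adding_machine n u" "u \<in> words n" by auto
    obtain i where i: "j = rotation n i" "i < n"
      using Cons.prems permutes_image [OF rotation_permutes, of n] by auto
    show ?case
      using u i Cons.prems
      by (intro image_eqI [of _ _ "i # (if i = n - 1 then u else v)"]) auto
  qed
  ultimately show "bij_betw (adding_machine n) (words n) (words n)"
    using w by (auto simp: bij_betw_def inj_on_def)
next
  fix u assume "u \<notin> words n"
  then show "adding_machine n u = u" by (cases u) auto
qed

lemma adding_machine_snoc:
  assumes "u \<in> words n" "i < n"
  shows "\<exists>j<n. adding_machine n (u @ [i]) = adding_machine n u @ [j]"
  using assms by (induction u) auto

lemma butlast_adding_machine: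
  "u \<in> words n \<Longrightarrow> butlast (adding_machine n u) = adding_machine n (butlast u)"
proof (cases u rule: rev_cases)
  case (snoc v i)
  moreover assume "u \<in> words n"
  ultimately show ?thesis using adding_machine_snoc [of v n i] by auto
qed auto

lemma adding_machine_tree_aut: "adding_machine n \<in> tree_auts n"
proof -
  let ?t = "adding_machine n"
  have adj: "tree_adj u v \<longleftrightarrow>
      (v \<noteq> [] \<and> butlast v = u) \<or> (u \<noteq> [] \<and> butlast u = v)" for u v
    by (metis append_butlast_last_id butlast_snoc snoc_eq_iff_butlast tree_adj_def)
  have ne: "?t u \<noteq> [] \<longleftrightarrow> u \<noteq> []" for u
    by (metis length_adding_machine length_0_conv)
  have eq: "?t u = ?t v \<longleftrightarrow> u = v" for u v
    using permutes_inj [OF adding_machine_permutes] by (auto dest: injD)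
  have "tree_adj (?t u) (?t v) = tree_adj u v" if "u \<in> words n" "v \<in> words n" for u v
    using that by (simp add: adj ne butlast_adding_machine eq)
  then show ?thesis by (simp add: tree_auts_def adding_machine_permutes)
qed

lemma activity_adding_machine: "activity n (adding_machine n) = rotation n"
  by (auto simp: activity_def rotation_def fun_eq_iff)

lemma section_adding_machine:
  "i < n \<Longrightarrow> section_at (adding_machine n) i = (if i = n - 1 then adding_machine n else id)"
proof
  fix u assume "i < n"
  then show "section_at (adding_machine n) i u = (if i = n - 1 then adding_machine n else id) u"
    using permutes_not_in [OF adding_machine_permutes, of u n] by (auto simp: section_at_def)
qed

end

theory Submission
  imports Defs "HOL-Number_Theory.Cong"
begin

text \<open>
  Let \<open>\<tau>\<close> be the adding machine. The map \<open>\<beta>\<close> permutes the \<open>n\<close> vertices of the first level in a single cycle, so \<open>\<beta> ^^ n\<close> fixes the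
  vertex \<open>0\<close> and induces on the subtree below it the first return map \<open>\<gamma> = (\<beta> ^^ n)|\<^sub>0\<close>. The core of the
  proof is that \<open>\<gamma>\<close> inherits every hypothesis on \<open>\<beta>\<close>, with the same exponent \<open>s\<close>. Hence \<open>\<gamma>\<close>, its
  first return map, and so on, all cycle through the first level: \<open>\<beta>\<close> is an odometer in the sense
  defined below. Such a \<open>\<beta>\<close> is conjugate to \<open>\<tau>\<close>; a conjugator \<open>g\<close> is given recursively by
  sending \<open>iu\<close> to the image under \<open>\<beta> ^^ i\<close> of \<open>0\<close> followed by the image of \<open>u\<close> under the
  conjugator for \<open>\<gamma>\<close> (\<open>odometer_conjugate\<close>).

  Commutation with conjugates is inherited (\<open>conjugates_commute_first_return\<close>) because \<open>\<tau>\<close> is its own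
  first return map: since \<open>\<beta>\<close> commutes with its conjugate by \<open>\<tau> ^^ (n * x)\<close>, so do the \<open>n\<close>-th powers,
  and on the subtree at \<open>0\<close> this says that \<open>\<gamma>\<close> commutes with its conjugate by \<open>\<tau> ^^ x\<close>.

  The activity of \<open>\<gamma>\<close> is read off the second level (\<open>return_pair_word\<close>), identified with the residues
  modulo \<open>n\<^sup>2\<close> in such a way that \<open>\<tau>\<close> becomes \<open>z \<mapsto> z + 1\<close>. Membership in the layer closure
  turns \<open>\<beta>\<close> into \<open>z \<mapsto> z + g(z)\<close>, where \<open>g(z)\<close> modulo \<open>n\<^sup>2\<close> depends only on \<open>z\<close> modulo \<open>n\<close> and
  \<open>g \<equiv> s\<close> modulo \<open>n\<close>. That \<open>\<beta>\<close> commutes with its conjugate by \<open>\<tau>\<close> means that \<open>g(z + s) - g(z)\<close> is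
  a constant \<open>c\<close> modulo \<open>n\<^sup>2\<close>, and \<open>c\<close> is divisible by \<open>n\<close>. Iterating,
  \<open>\<beta> ^^ n\<close> takes \<open>z\<close> to \<open>z + n g(z) + c n (n - 1) / 2\<close>. For odd \<open>n\<close> the last term vanishes modulo
  \<open>n\<^sup>2\<close>, which leaves \<open>z + n s\<close>.
\<close>

section \<open>Tree automorphisms\<close>

lemma tree_aut_comp:
  "\<alpha> \<in> tree_auts n \<Longrightarrow> \<beta> \<in> tree_auts n \<Longrightarrow> \<beta> \<circ> \<alpha> \<in> tree_auts n"
  by (auto simp: tree_auts_def permutes_in_image intro: permutes_compose)

lemma tree_aut_funpow: "\<alpha> \<in> tree_auts n \<Longrightarrow> \<alpha> ^^ k \<in> tree_auts n"
proof (induction k)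
  case 0
  then show ?case by (simp add: tree_auts_def permutes_id flip: id_def)
next
  case (Suc k)
  then show ?case using tree_aut_comp [of "\<alpha> ^^ k" n \<alpha>] by (simp del: comp_apply)
qed

lemma length_tree_aut:
  assumes "\<alpha> \<in> tree_auts n" "u \<in> words n"
  shows "length (\<alpha> u) = length u"
  using assms(2)
proof (induction u rule: rev_induct)
  case Nil
  then show ?case using assms(1) by (simp add: tree_auts_def)
next
  case (snoc i u)
  then show ?case using tree_aut_snoc [OF assms(1), of u i] by auto
qed

lemma tree_aut_outside: "\<alpha> \<in> tree_auts n \<Longrightarrow> u \<notin> words n \<Longrightarrow> \<alpha> u = u"
  by (auto simp: tree_auts_def intro: permutes_not_in)

text \<open>Surjectivity is automatic, because each level of the tree is finite.\<close>
lemma tree_autI: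
  assumes inj: "inj_on f (words n)"
    and nil: "f [] = []"
    and snoc: "\<And>u i. u \<in> words n \<Longrightarrow> i < n \<Longrightarrow> \<exists>j<n. f (u @ [i]) = f u @ [j]"
    and outside: "\<And>u. u \<notin> words n \<Longrightarrow> f u = u"
  shows "f \<in> tree_auts n"
proof -
  have *: "f u \<in> words n \<and> length (f u) = length u" if "u \<in> words n" for u
    using that
  proof (induction u rule: rev_induct)
    case (snoc i u)
    then show ?case using assms(3) [of u i] by auto
  qed (simp add: nil)
  have "v \<in> f ` words n" if v: "v \<in> words n" for v
  proof -
    let ?W = "{u. set u \<subseteq> {..<n} \<and> length u = length v}"
    have W: "?W \<subseteq> words n" by (auto simp: words_def lists_eq_set)
    have "f ` ?W = ?W"
    proof (rule endo_inj_surj)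
      show "finite ?W" by (rule finite_lists_length_eq) simp
      show "f ` ?W \<subseteq> ?W"
      proof
        fix w assume "w \<in> f ` ?W"
        then obtain u where u: "u \<in> ?W" "w = f u" by blast
        then have "u \<in> words n" using W by blast
        then have "w \<in> words n" "length w = length v" using * [of u] u by auto
        then show "w \<in> ?W" by (simp add: words_def lists_eq_set)
      qed
      show "inj_on f ?W" using inj W by (rule inj_on_subset)
    qed
    moreover have "v \<in> ?W" using v by (auto simp: words_def lists_eq_set)
    ultimately have "v \<in> f ` ?W" by simp
    then show ?thesis using W by blast
  qed
  then have "bij_betw f (words n) (words n)" using * inj by (auto simp: bij_betw_def)
  then have p: "f permutes words n" using outside by (rule bij_imp_permutes)
  have eq: "f u = f v \<longleftrightarrow> u = v" for u v
    using permutes_inj [OF p] by (auto dest: injD)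
  have adj: "tree_adj u v \<longleftrightarrow>
      (v \<noteq> [] \<and> butlast v = u) \<or> (u \<noteq> [] \<and> butlast u = v)" for u v
    by (metis append_butlast_last_id butlast_snoc snoc_eq_iff_butlast tree_adj_def)
  have bl: "butlast (f u) = f (butlast u)" if "u \<in> words n" for u
    using that
  proof (cases u rule: rev_cases)
    case (snoc v i)
    then show ?thesis using assms(3) [of v i] that by auto
  qed (simp add: nil)
  have ne: "f u \<noteq> [] \<longleftrightarrow> u \<noteq> []" for u using eq [of u "[]"] by (simp add: nil)
  have "tree_adj (f u) (f v) = tree_adj u v" if "u \<in> words n" "v \<in> words n" for u v
    using that by (simp add: adj ne bl eq)
  then show ?thesis using p nil by (simp add: tree_auts_def)
qed

lemma mult_aut_tree: "\<alpha> \<otimes>\<^bsub>aut_tree n\<^esub> \<beta> = \<beta> \<circ> \<alpha>"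
  by (simp add: aut_tree_def perm_group_def)

lemma one_aut_tree: "\<one>\<^bsub>aut_tree n\<^esub> = id"
  by (simp add: aut_tree_def perm_group_def)

lemma carrier_aut_tree: "carrier (aut_tree n) = tree_auts n"
  by (simp add: aut_tree_def)

lemma tree_aut_bij: "\<alpha> \<in> tree_auts n \<Longrightarrow> bij \<alpha>"
  by (auto simp: tree_auts_def intro: permutes_bij)

lemma inv_aut_tree: "\<alpha> \<in> tree_auts n \<Longrightarrow> inv\<^bsub>aut_tree n\<^esub> \<alpha> = inv_into UNIV \<alpha>"
  by (rule group.inv_equality [OF group_aut_tree])
    (auto simp: mult_aut_tree one_aut_tree carrier_aut_tree inv_tree_aut
       bij_is_surj surj_iff [symmetric] tree_aut_bij)

lemma nat_pow_aut_tree: "\<alpha> [^]\<^bsub>aut_tree n\<^esub> (k::nat) = \<alpha> ^^ k"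
  by (induction k) (simp_all add: one_aut_tree mult_aut_tree)


section \<open>Automorphisms all of whose states act on letters by rotations\<close>

text \<open>
  The letter following the prefix \<open>v\<close> is shifted by an amount that depends on \<open>v\<close> only.
  For tree automorphisms this is membership in the layer closure of the group generated by the
  rotation; in this form closure under products and sections is immediate.
\<close>
definition rotational :: "nat \<Rightarrow> (nat list \<Rightarrow> nat list) \<Rightarrow> bool" where
  "rotational n \<alpha> \<longleftrightarrow> (\<forall>v\<in>words n. \<exists>m::int. \<forall>j<n. \<alpha> (v @ [j]) = \<alpha> v @ [nat ((int j + m) mod int n)])"

lemma rotational_comp:
  assumes "\<alpha> \<in> tree_auts n" "rotational n \<alpha>" "rotational n \<beta>"
  shows "rotational n (\<beta> \<circ> \<alpha>)"
  unfolding rotational_def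
proof
  fix v assume v: "v \<in> words n"
  then have av: "\<alpha> v \<in> words n" using assms(1) by (simp add: tree_aut_in_words)
  obtain m where m: "\<And>j. j < n \<Longrightarrow> \<alpha> (v @ [j]) = \<alpha> v @ [nat ((int j + m) mod int n)]"
    using assms(2) v unfolding rotational_def by meson
  obtain k where k: "\<And>j. j < n \<Longrightarrow> \<beta> (\<alpha> v @ [j]) = \<beta> (\<alpha> v) @ [nat ((int j + k) mod int n)]"
    using assms(3) av unfolding rotational_def by meson
  have "(\<beta> \<circ> \<alpha>) (v @ [j]) = (\<beta> \<circ> \<alpha>) v @ [nat ((int j + (m + k)) mod int n)]" if "j < n" for j
  proof -
    have "nat ((int j + m) mod int n) < n" using that by (simp add: nat_less_iff)
    then show ?thesis using that by (simp add: m k mod_simps add.assoc)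
  qed
  then show "\<exists>m::int. \<forall>j<n. (\<beta> \<circ> \<alpha>) (v @ [j]) = (\<beta> \<circ> \<alpha>) v @ [nat ((int j + m) mod int n)]"
    by blast
qed

lemma rotational_funpow:
  assumes "\<alpha> \<in> tree_auts n" "rotational n \<alpha>"
  shows "rotational n (\<alpha> ^^ k)"
proof (induction k)
  case 0
  have "rotational n id" unfolding rotational_def by (auto intro: exI [of _ 0])
  then show ?case by (simp add: id_def)
next
  case (Suc k)
  then show ?case using rotational_comp [of "\<alpha> ^^ k" n \<alpha>] assms tree_aut_funpow by (simp add: comp_def)
qed

lemma rotational_section:
  assumes "\<alpha> \<in> tree_auts n" "rotational n \<alpha>" "i < n"
  shows "rotational n (section_at \<alpha> i)"
  unfolding rotational_def
proof
  fix v assume v: "v \<in> words n"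
  then obtain m where m: "\<And>j. j < n \<Longrightarrow> \<alpha> (i # v @ [j]) = \<alpha> (i # v) @ [nat ((int j + m) mod int n)]"
    using assms(2) bspec [of "words n" _ "i # v"] \<open>i < n\<close> unfolding rotational_def
    by (metis append_Cons words_simps(2))
  have "\<alpha> (i # v) \<noteq> []" using tree_aut_Cons [OF assms(1,3) v] by simp
  then have "section_at \<alpha> i (v @ [j]) = section_at \<alpha> i v @ [nat ((int j + m) mod int n)]" if "j < n" for j
    using m [OF that] by (simp add: section_at_def)
  then show "\<exists>m::int. \<forall>j<n. section_at \<alpha> i (v @ [j]) = section_at \<alpha> i v @ [nat ((int j + m) mod int n)]"
    by blast
qed

lemma tree_aut_append_state:
  assumes "\<alpha> \<in> tree_auts n" "v \<in> words n" "j < n"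
  shows "\<alpha> (v @ [j]) = \<alpha> v @ [activity n (state \<alpha> v) j]"
  using assms(1,2)
proof (induction v arbitrary: \<alpha>)
  case Nil
  then show ?case using tree_aut_singleton [OF Nil.prems(1) assms(3)]
    by (simp add: state_def tree_auts_def)
next
  case (Cons i v)
  then have "section_at \<alpha> i (v @ [j]) = section_at \<alpha> i v @ [activity n (state (section_at \<alpha> i) v) j]"
    by (auto intro: section_tree_aut)
  then show ?case using Cons.prems assms(3)
    by (simp add: tree_aut_Cons state_def)
qed

lemma carrier_perm_group: "carrier (perm_group S) = {p. p permutes S}"
  by (simp add: perm_group_def)

lemma inv_rotation:
  assumes "j < n"
  shows "(inv\<^bsub>perm_group {..<n}\<^esub> (rotation n)) j = nat ((int j - 1) mod int n)"
proof -
  let ?k = "nat ((int j - 1) mod int n)"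
  have k: "?k < n" using assms by (simp add: nat_less_iff)
  have "int (rotation n ?k) = ((int j - 1) mod int n + 1) mod int n"
    using k assms by (simp add: rotation_def zmod_int add.commute)
  also have "\<dots> = int j" using assms by (simp add: mod_simps)
  finally have "rotation n ?k = j" by simp
  then show ?thesis
    unfolding inv_perm_group [OF rotation_permutes]
    using permutes_inv_eq [OF rotation_permutes] by blast
qed

lemma rotation_eq: "j < n \<Longrightarrow> rotation n j = nat ((int j + 1) mod int n)"
  by (simp add: rotation_def nat_mod_distrib nat_add_distrib)

lemma generate_rotation:
  assumes "p \<in> generate (perm_group {..<n}) {rotation n}"
  shows "\<exists>m::int. \<forall>j<n. p j = nat ((int j + m) mod int n)"
  using assms
proof (induction rule: generate.induct)
  case one
  then show ?case by (auto simp: perm_group_def intro: exI [of _ 0])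
next
  case (incl h)
  then show ?case using rotation_eq by blast
next
  case (inv h)
  then show ?case by (auto simp: inv_rotation intro!: exI [of _ "-1"])
next
  case (eng p q)
  then obtain m k :: int where
    m: "\<And>j. j < n \<Longrightarrow> p j = nat ((int j + m) mod int n)" and
    k: "\<And>j. j < n \<Longrightarrow> q j = nat ((int j + k) mod int n)" by blast
  have "(p \<otimes>\<^bsub>perm_group {..<n}\<^esub> q) j = nat ((int j + (m + k)) mod int n)" if "j < n" for j
  proof -
    have "nat ((int j + m) mod int n) < n" using that by (simp add: nat_less_iff)
    then show ?thesis using that by (simp add: m k perm_group_def mod_simps add.assoc)
  qed
  then show ?case by blast
qed

lemma rotational_layer_closure:
  assumes "\<alpha> \<in> layer_closure n (generate (perm_group {..<n}) {rotation n})"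
  shows "\<alpha> \<in> tree_auts n" "rotational n \<alpha>"
proof -
  show a: "\<alpha> \<in> tree_auts n"
    using assms by (simp add: layer_closure_def carrier_aut_tree)
  show "rotational n \<alpha>"
    unfolding rotational_def
  proof
    fix v assume v: "v \<in> words n"
    then have "activity n (state \<alpha> v) \<in> generate (perm_group {..<n}) {rotation n}"
      using assms by (simp add: layer_closure_def)
    from generate_rotation [OF this]
    show "\<exists>m::int. \<forall>j<n. \<alpha> (v @ [j]) = \<alpha> v @ [nat ((int j + m) mod int n)]"
      using tree_aut_append_state [OF a v] by auto
  qed
qed

lemma rotation_int_pow:
  assumes "j < n"
  shows "(rotation n [^]\<^bsub>perm_group {..<n}\<^esub> (s::int)) j = nat ((int j + s) mod int n)"
proof -
  interpret group "perm_group {..<n}" by (rule group_perm_group)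
  have c: "rotation n \<in> carrier (perm_group {..<n})"
    by (simp add: carrier_perm_group rotation_permutes)
  show ?thesis
  proof (induction s rule: int_induct [where k = 0])
    case base
    then show ?case using assms by (simp add: perm_group_def)
  next
    case (step1 s)
    have "nat ((int j + s) mod int n) < n" using assms by (simp add: nat_less_iff)
    then show ?case using step1 assms
      by (simp add: int_pow_mult [OF c] int_pow_1 [OF c]) 
        (simp add: perm_group_def rotation_eq mod_simps add.assoc)
  next
    case (step2 s)
    have "nat ((int j + s) mod int n) < n" using assms by (simp add: nat_less_iff)
    moreover have "rotation n [^]\<^bsub>perm_group {..<n}\<^esub> (s - 1) =
        inv\<^bsub>perm_group {..<n}\<^esub> (rotation n) \<circ> rotation n [^]\<^bsub>perm_group {..<n}\<^esub> s"
      using int_pow_mult [OF c, of s "-1"] int_pow_neg [OF c, of 1] int_pow_1 [OF c]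
      by (simp add: perm_group_def)
    ultimately show ?case using step2 assms
      by (simp add: inv_rotation mod_simps add_diff_eq)
  qed
qed


section \<open>Odometers are conjugate to the adding machine\<close>

text \<open>
  The return map to the subtree at the letter \<open>0\<close>, with \<open>\<beta> ^^ n\<close> as the returning power. It is only
  meaningful when \<open>\<beta>\<close> permutes the letters in an \<open>n\<close>-cycle.
\<close>
definition first_return :: "nat \<Rightarrow> (nat list \<Rightarrow> nat list) \<Rightarrow> nat list \<Rightarrow> nat list" where
  "first_return n \<beta> = section_at (\<beta> ^^ n) 0"

text \<open>
  A tree automorphism that permutes the first level in an \<open>n\<close>-cycle, such that its first return map,
  the first return map of that, and so on forever, do so as well. Equivalently, it acts transitively on
  every level.
\<close>
coinductive odometer :: "nat \<Rightarrow> (nat list \<Rightarrow> nat list) \<Rightarrow> bool" for n where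
  "odometer n \<beta>"
  if "\<beta> \<in> tree_auts n" "inj_on (\<lambda>i. (\<beta> ^^ i) [0]) {..<n}" "(\<beta> ^^ n) [0] = [0]"
    "odometer n (first_return n \<beta>)"

text \<open>
  For an odometer \<open>\<beta>\<close> and the adding machine \<open>\<tau>\<close>, the word \<open>\<tau>\<^sup>m(0\<dots>0)\<close> goes to \<open>\<beta>\<^sup>m(0\<dots>0)\<close>. The recursion writes \<open>m = i + n m'\<close> and uses that \<open>\<beta>\<^sup>n\<close> acts
  below the letter \<open>0\<close> as the first return map of \<open>\<beta>\<close>.
\<close>
fun odometer_conj :: "nat \<Rightarrow> (nat list \<Rightarrow> nat list) \<Rightarrow> nat list \<Rightarrow> nat list" where
  "odometer_conj n \<beta> [] = []"
| "odometer_conj n \<beta> (i # u) =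
     (if i # u \<in> words n then (\<beta> ^^ i) (0 # odometer_conj n (first_return n \<beta>) u) else i # u)"

lemma first_return_Cons:
  assumes "\<beta> \<in> tree_auts n" "(\<beta> ^^ n) [0] = [0]" "0 < n"
  shows "first_return n \<beta> \<in> tree_auts n" "(\<beta> ^^ n) (0 # u) = 0 # first_return n \<beta> u"
proof -
  have b: "\<beta> ^^ n \<in> tree_auts n" by (rule tree_aut_funpow [OF assms(1)])
  show f: "first_return n \<beta> \<in> tree_auts n"
    unfolding first_return_def by (rule section_tree_aut [OF b assms(3)])
  show "(\<beta> ^^ n) (0 # u) = 0 # first_return n \<beta> u"
  proof (cases "u \<in> words n")
    case True
    then show ?thesis using tree_aut_Cons [OF b assms(3) True] assms
      by (simp add: first_return_def activity_def)
  next
    case False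
    then show ?thesis using tree_aut_outside [OF f False] tree_aut_outside [OF b, of "0 # u"] by simp
  qed
qed

lemma odometer_conj_words:
  "odometer n \<beta> \<Longrightarrow> u \<in> words n \<Longrightarrow> odometer_conj n \<beta> u \<in> words n"
proof (induction u arbitrary: \<beta>)
  case (Cons i u)
  from Cons.prems(1) show ?case
    by cases (use Cons in \<open>auto simp: tree_aut_in_words [OF tree_aut_funpow]\<close>)
qed simp

lemma odometer_conj_snoc:
  "odometer n \<beta> \<Longrightarrow> u \<in> words n \<Longrightarrow> i < n \<Longrightarrow>
     \<exists>j<n. odometer_conj n \<beta> (u @ [i]) = odometer_conj n \<beta> u @ [j]"
proof (induction u arbitrary: \<beta>)
  case Nil
  from Nil(1) show ?case
    by cases (use Nil tree_aut_singleton [OF tree_aut_funpow, of \<beta> n 0 i] in auto)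
next
  case (Cons k u)
  from Cons.prems(1) show ?case
  proof cases
    case 1
    obtain j where j: "j < n" "odometer_conj n (first_return n \<beta>) (u @ [i]) =
        odometer_conj n (first_return n \<beta>) u @ [j]"
      using Cons 1 by auto
    have "0 # odometer_conj n (first_return n \<beta>) u \<in> words n"
      using 1 Cons.prems odometer_conj_words by auto
    from tree_aut_snoc [OF tree_aut_funpow [OF 1(1), of k] this j(1)] show ?thesis
      using Cons.prems j by simp
  qed
qed

lemma odometer_conj_inj:
  "odometer n \<beta> \<Longrightarrow> u \<in> words n \<Longrightarrow> v \<in> words n \<Longrightarrow>
     odometer_conj n \<beta> u = odometer_conj n \<beta> v \<Longrightarrow> u = v"
proof (induction u arbitrary: \<beta> v)
  have ne: "odometer_conj n \<beta> (i # u) \<noteq> []" if "odometer n \<beta>" "i # u \<in> words n" for \<beta> i u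
    using that(1)
  proof cases
    case 1
    then show ?thesis
      using that odometer_conj_words [OF 1(4), of u]
        length_tree_aut [OF tree_aut_funpow [OF 1(1), of i], of "0 # odometer_conj n (first_return n \<beta>) u"]
      by auto
  qed
  {
    case Nil
    then show ?case using ne by (cases v) (force simp del: odometer_conj.simps(2))+
  next
    case (Cons i u)
    then obtain j w where v: "v = j # w"
      using ne [of \<beta> i u] by (cases v) (auto simp del: odometer_conj.simps(2))
    from Cons.prems(1) show ?case
    proof cases
      case 1
      let ?\<gamma> = "first_return n \<beta>"
      let ?x = "odometer_conj n ?\<gamma> u" and ?y = "odometer_conj n ?\<gamma> w"
      have b: "\<beta> ^^ k \<in> tree_auts n" for k by (rule tree_aut_funpow [OF 1(1)])
      have w: "?x \<in> words n" "?y \<in> words n" "0 < n" "i < n" "j < n" "u \<in> words n" "w \<in> words n"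
        using Cons.prems v 1 by (auto intro: odometer_conj_words)
      have eq: "(\<beta> ^^ i) (0 # ?x) = (\<beta> ^^ j) (0 # ?y)" using Cons.prems w v by simp
      have "(\<beta> ^^ i) [0] = (\<beta> ^^ j) [0]"
        using eq w tree_aut_Cons [OF b, of 0] tree_aut_singleton(1) [OF b, of 0] by simp
      then have "i = j" using 1(2) w by (auto dest: inj_onD)
      then have "?x = ?y" using eq tree_aut_inj [OF b] by simp
      then have "u = w" using Cons.IH [OF 1(4)] w by blast
      then show ?thesis using v \<open>i = j\<close> by simp
    qed
  }
qed

lemma odometer_conj_adding_machine:
  "odometer n \<beta> \<Longrightarrow> odometer_conj n \<beta> (adding_machine n u) = \<beta> (odometer_conj n \<beta> u)"
proof (induction u arbitrary: \<beta>)
  case Nil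
  from Nil show ?case by cases (simp add: tree_auts_def)
next
  case (Cons i u)
  from Cons.prems show ?case
  proof cases
    case 1
    consider "i # u \<notin> words n" | "i # u \<in> words n" "i < n - 1" | "i # u \<in> words n" "i = n - 1"
      by fastforce
    then show ?thesis
    proof cases
      case 1
      then show ?thesis using \<open>\<beta> \<in> tree_auts n\<close> by (auto simp: tree_aut_outside)
    next
      case 2
      then show ?thesis by (auto simp: rotation_def)
    next
      case 3
      \<comment> \<open>The carry: the adding machine continues into \<open>u\<close>, while \<open>\<beta>\<close> completes its cycle through the letters.\<close>
      then have n: "0 < n" "u \<in> words n" by auto
      have "odometer_conj n \<beta> (adding_machine n (i # u)) =
          0 # odometer_conj n (first_return n \<beta>) (adding_machine n u)"
        using 3 n permutes_in_image [OF adding_machine_permutes, of n u] by (simp add: rotation_def)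
      also have "\<dots> = (\<beta> ^^ Suc i) (0 # odometer_conj n (first_return n \<beta>) u)"
        using Cons.IH [OF 1(4)] first_return_Cons(2) [OF 1(1,3)] 3 n by simp
      finally show ?thesis using 3 by simp
    qed
  qed
qed

theorem odometer_conjugate:
  assumes "odometer n \<beta>"
  shows "conjugate_in (aut_tree n) \<beta> (adding_machine n)"
proof -
  let ?g = "odometer_conj n \<beta>"
  have g: "?g \<in> tree_auts n"
  proof (rule tree_autI)
    show "inj_on ?g (words n)" using odometer_conj_inj [OF assms] by (auto intro: inj_onI)
    show "?g u = u" if "u \<notin> words n" for u using that by (cases u) auto
  qed (use odometer_conj_snoc [OF assms] in auto)
  have "?g \<circ> adding_machine n = \<beta> \<circ> ?g"
    using odometer_conj_adding_machine [OF assms] by auto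
  then have "?g \<circ> adding_machine n \<circ> inv_into UNIV ?g = \<beta>"
    using tree_aut_bij [OF g] by (metis bij_is_surj comp_assoc comp_id surj_iff)
  then show ?thesis unfolding conjugate_in_def
    using g by (intro bexI [of _ ?g])
      (auto simp: conj_by_def mult_aut_tree inv_aut_tree carrier_aut_tree comp_assoc)
qed


section \<open>Passing to the first return map\<close>

text \<open>
  The conjugates of \<open>\<beta>\<close> by the powers of the adding machine commute with \<open>\<beta>\<close>. Nonnegative powers suffice,
  as \<open>\<beta>\<close> commutes with its conjugate by \<open>\<kappa>\<close> if and only if it does with that by the inverse of \<open>\<kappa>\<close>.
  Maps compose as functions here, so the conjugate \<open>\<kappa>\<^sup>-\<^sup>1\<beta>\<kappa>\<close> of the right action is
  \<open>\<kappa> \<circ> \<beta> \<circ> \<kappa>\<^sup>-\<^sup>1\<close>.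
\<close>
definition conjugates_commute :: "nat \<Rightarrow> (nat list \<Rightarrow> nat list) \<Rightarrow> bool" where
  "conjugates_commute n \<beta> \<longleftrightarrow> (\<forall>x. let \<kappa> = adding_machine n ^^ x; \<alpha> = \<kappa> \<circ> \<beta> \<circ> inv_into UNIV \<kappa>
     in \<beta> \<circ> \<alpha> = \<alpha> \<circ> \<beta>)"

lemma funpow_comp_commute:
  assumes "f \<circ> g = g \<circ> f"
  shows "f ^^ k \<circ> g ^^ l = g ^^ l \<circ> f ^^ k"
proof -
  have *: "f ^^ k \<circ> h = h \<circ> f ^^ k" if "f \<circ> h = h \<circ> f" for f h :: "'a \<Rightarrow> 'a" and k
    using that by (induction k) (auto simp: fun_eq_iff)
  show ?thesis using * [OF * [OF assms, symmetric], where k = l] by simp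
qed

lemma funpow_conj:
  assumes "bij t"
  shows "(t \<circ> f \<circ> inv_into UNIV t) ^^ k = t \<circ> f ^^ k \<circ> inv_into UNIV t"
proof (induction k)
  case 0
  then show ?case using assms by (simp add: fun_eq_iff bij_is_surj surj_f_inv_f)
next
  case (Suc k)
  have "inv_into UNIV t (t x) = x" for x using assms by (simp add: bij_is_inj)
  then show ?case unfolding funpow.simps Suc by (simp add: fun_eq_iff)
qed

lemma adding_machine_funpow_Cons:
  "i # u \<in> words n \<Longrightarrow> (adding_machine n ^^ i) (0 # u) = i # u"
  by (induction i) (auto simp: rotation_def)

lemma adding_machine_return:
  assumes "0 < n"
  shows "(adding_machine n ^^ n) (0 # u) = 0 # adding_machine n u"
proof (cases "u \<in> words n")
  case True
  obtain m where m: "n = Suc m" using assms by (cases n) auto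
  have "(adding_machine n ^^ n) (0 # u) = adding_machine n ((adding_machine n ^^ m) (0 # u))"
    unfolding m by simp
  also have "\<dots> = 0 # adding_machine n u"
    using True m adding_machine_funpow_Cons [of m u n] by (simp add: rotation_def)
  finally show ?thesis .
next
  case False
  then show ?thesis
    using tree_aut_outside [OF tree_aut_funpow [OF adding_machine_tree_aut, of n n], of "0 # u"]
      tree_aut_outside [OF adding_machine_tree_aut, of u n] by simp
qed

text \<open>
  The power \<open>\<tau> ^^ (n * x)\<close> of the adding machine preserves the subtree at \<open>0\<close> and acts on it as \<open>\<tau> ^^ x\<close>. Hence the
  \<open>n\<close>-th power of the conjugate of \<open>\<beta>\<close> by it acts there as the conjugate of the first return map by \<open>\<tau> ^^ x\<close>.
\<close>
lemma conjugates_commute_first_return: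
  assumes b: "\<beta> \<in> tree_auts n" "(\<beta> ^^ n) [0] = [0]" "0 < n"
    and comm: "conjugates_commute n \<beta>"
  shows "conjugates_commute n (first_return n \<beta>)"
  unfolding conjugates_commute_def Let_def
proof
  fix x
  let ?t = "adding_machine n ^^ x" and ?T = "adding_machine n ^^ (n * x)"
  let ?\<gamma> = "first_return n \<beta>"
  have bij: "bij ?t" "bij ?T"
    by (rule tree_aut_bij [OF tree_aut_funpow [OF adding_machine_tree_aut]])+
  have T: "?T (0 # u) = 0 # ?t u" for u
    unfolding funpow_mult [symmetric]
    by (induction x arbitrary: u) (simp_all add: adding_machine_return [OF b(3)])
  have T': "inv_into UNIV ?T (0 # u) = 0 # inv_into UNIV ?t u" for u
    using T [of "inv_into UNIV ?t u"] bij
    by (metis bij_inv_eq_iff)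
  define \<alpha> where "\<alpha> = ?T \<circ> \<beta> \<circ> inv_into UNIV ?T"
  have "\<beta> \<circ> \<alpha> = \<alpha> \<circ> \<beta>"
    using comm unfolding conjugates_commute_def Let_def \<alpha>_def by blast
  then have "\<beta> ^^ n \<circ> \<alpha> ^^ n = \<alpha> ^^ n \<circ> \<beta> ^^ n" by (rule funpow_comp_commute)
  then have eq: "(\<beta> ^^ n) ((\<alpha> ^^ n) (0 # u)) = (\<alpha> ^^ n) ((\<beta> ^^ n) (0 # u))" for u
    by (simp add: fun_eq_iff)
  have "(\<alpha> ^^ n) (0 # u) = 0 # (?t \<circ> ?\<gamma> \<circ> inv_into UNIV ?t) u" for u
    unfolding \<alpha>_def funpow_conj [OF bij(2)]
    by (simp add: T T' first_return_Cons(2) [OF b])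
  then have "?\<gamma> ((?t \<circ> ?\<gamma> \<circ> inv_into UNIV ?t) u) = (?t \<circ> ?\<gamma> \<circ> inv_into UNIV ?t) (?\<gamma> u)" for u
    using eq [of u] by (simp add: first_return_Cons(2) [OF b])
  then show "?\<gamma> \<circ> (?t \<circ> ?\<gamma> \<circ> inv_into UNIV ?t) = (?t \<circ> ?\<gamma> \<circ> inv_into UNIV ?t) \<circ> ?\<gamma>"
    by (simp add: fun_eq_iff)
qed

section \<open>Displacements on the second level\<close>

text \<open>The words of length two, as residues modulo \<open>n\<^sup>2\<close> written in base \<open>n\<close>, least significant digit first.\<close>
definition pair_word :: "nat \<Rightarrow> int \<Rightarrow> nat list" where
  "pair_word n z = [nat (z mod int n), nat (z div int n mod int n)]"

lemma pair_word_eq_iff: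
  assumes "0 < n"
  shows "pair_word n z = pair_word n w \<longleftrightarrow> [z = w] (mod (int n * int n))"
proof -
  have e: "a mod (int n * int n) = int n * (a div int n mod int n) + a mod int n" for a
    by (rule zmod_zmult2_eq) simp
  have d: "a mod (int n * int n) div int n = a div int n mod int n" for a
    unfolding e using assms by simp
  have m: "a mod (int n * int n) mod int n = a mod int n" for a
    by (rule mod_mod_cancel) simp
  have "pair_word n z = pair_word n w \<longleftrightarrow>
      z mod int n = w mod int n \<and> z div int n mod int n = w div int n mod int n"
    using assms by (simp add: pair_word_def nat_eq_iff)
  also have "\<dots> \<longleftrightarrow> [z = w] (mod (int n * int n))"
    unfolding cong_def using e d m by metis
  finally show ?thesis .
qed

lemma pair_word_digits:
  assumes "0 \<le> a" "a < int n"
  shows "pair_word n (a + int n * q) = [nat a, nat (q mod int n)]"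
  using assms by (simp add: pair_word_def)

lemma adding_machine_pair_word:
  assumes "0 < n"
  shows "adding_machine n (pair_word n z) = pair_word n (z + 1)"
proof -
  define a q where "a = z mod int n" and "q = z div int n"
  have a: "0 \<le> a" "a < int n" using assms by (auto simp: a_def)
  have z: "z = a + int n * q" by (simp add: a_def q_def)
  have q: "nat (q mod int n) < n" "int (nat (q mod int n)) = q mod int n"
    using assms by (auto simp: nat_less_iff)
  show ?thesis
  proof (cases "a = int n - 1")
    case True
    then have "z + 1 = 0 + int n * (q + 1)" by (simp add: z algebra_simps)
    then have "pair_word n (z + 1) = [0, nat ((q + 1) mod int n)]"
      using pair_word_digits [of 0 n "q + 1"] assms by simp
    moreover have "nat a = n - 1" using True by simp
    ultimately show ?thesis
      using q assms a True
      by (simp add: z pair_word_digits rotation_eq mod_simps)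
  next
    case False
    then have "pair_word n (z + 1) = [nat (a + 1), nat (q mod int n)]"
      using pair_word_digits [of "a + 1" n q] a by (simp add: z algebra_simps)
    then show ?thesis
      using q a False by (auto simp: z pair_word_digits rotation_eq nat_less_iff)
  qed
qed

text \<open>
  On the second level such an automorphism is \<open>z \<mapsto> z + g z\<close>, where the displacement \<open>g z\<close> depends only
  on the first digit of \<open>z\<close>.
\<close>
lemma pair_word_displacement:
  assumes b: "\<beta> \<in> tree_auts n" "rotational n \<beta>" "0 < n"
    and s: "\<And>j. j < n \<Longrightarrow> \<beta> [j] = [nat ((int j + s) mod int n)]"
  obtains g :: "int \<Rightarrow> int" where
    "\<And>z. \<beta> (pair_word n z) = pair_word n (z + g z)"
    "\<And>z w. [z = w] (mod int n) \<Longrightarrow> g z = g w"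
    "\<And>z. [g z = s] (mod int n)"
proof -
  have "\<exists>m::int. \<forall>j<n. \<beta> [i, j] = \<beta> [i] @ [nat ((int j + m) mod int n)]" if "i < n" for i
    using b(2) [unfolded rotational_def, rule_format, of "[i]"] that by simp
  then obtain m where m: "\<And>i j. i < n \<Longrightarrow> j < n \<Longrightarrow>
      \<beta> [i, j] = \<beta> [i] @ [nat ((int j + m i) mod int n)]"
    by metis
  \<comment> \<open>The difference of the first two terms is \<open>s\<close> modulo \<open>n\<close>, and adding it to \<open>z\<close> never carries.\<close>
  define g where "g z = (z mod int n + s) mod int n - z mod int n + int n * m (nat (z mod int n))" for z
  show thesis
  proof (rule that [of g])
    fix z w :: int
    show "g z = g w" if "[z = w] (mod int n)" using that by (simp add: g_def cong_def)
    show "[g z = s] (mod int n)" by (simp add: g_def cong_def mod_simps)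
    define a q where "a = z mod int n" and "q = z div int n"
    have a: "0 \<le> a" "a < int n" using b(3) by (auto simp: a_def)
    have z: "z = a + int n * q" by (simp add: a_def q_def)
    have "z + g z = (a + s) mod int n + int n * (q + m (nat a))"
      by (simp add: g_def flip: a_def) (simp add: z algebra_simps)
    then have "pair_word n (z + g z) = [nat ((a + s) mod int n), nat ((q + m (nat a)) mod int n)]"
      using b(3) by (simp add: pair_word_digits)
    moreover have "nat a < n" "nat (q mod int n) < n" using a b(3) by (auto simp: nat_less_iff)
    ultimately show "\<beta> (pair_word n z) = pair_word n (z + g z)"
      using a b(3) by (simp add: z pair_word_digits m s mod_simps)
  qed
qed

text \<open>
  The displacements along the orbit of \<open>z\<close> form, modulo \<open>n\<^sup>2\<close>, an arithmetic progression of length \<open>n\<close>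
  whose common difference is a multiple of \<open>n\<close>, and each of them is \<open>s\<close> modulo \<open>n\<close>. As \<open>n\<close> is odd,
  their sum is \<open>n * s\<close>.
\<close>
lemma return_pair_word:
  assumes b: "\<beta> \<in> tree_auts n" "rotational n \<beta>" "0 < n" "odd n"
    and s: "\<And>j. j < n \<Longrightarrow> \<beta> [j] = [nat ((int j + s) mod int n)]"
    and comm: "conjugates_commute n \<beta>"
  shows "(\<beta> ^^ n) (pair_word n z) = pair_word n (z + int n * s)"
proof -
  let ?N = "int n * int n"
  obtain g where bg: "\<And>z. \<beta> (pair_word n z) = pair_word n (z + g z)"
    and per: "\<And>z w. [z = w] (mod int n) \<Longrightarrow> g z = g w"
    and gs: "\<And>z. [g z = s] (mod int n)"
    by (rule pair_word_displacement [OF b(1,2,3) s]) auto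
  note t = adding_machine_pair_word [OF b(3)]
  have gg: "g (z + g w) = g (z + s)" for z w
    by (rule per) (intro cong_add gs cong_refl)
  have step: "[g (z + 1 + s) - g (z + 1) = g (z + s) - g z] (mod ?N)" for z
  proof -
    have bij: "bij (adding_machine n)" by (rule tree_aut_bij [OF adding_machine_tree_aut])
    let ?t' = "inv_into UNIV (adding_machine n)"
    have t': "?t' (pair_word n (w + 1)) = pair_word n w" for w
      using bij by (simp add: bij_is_inj flip: t)
    \<comment> \<open>Conjugation by the adding machine itself is enough; the relation is evaluated at \<open>z + 1\<close>.\<close>
    have "\<beta> \<circ> (adding_machine n \<circ> \<beta> \<circ> ?t') = (adding_machine n \<circ> \<beta> \<circ> ?t') \<circ> \<beta>"
      using comm [unfolded conjugates_commute_def Let_def, rule_format, of 1] by simp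
    then have "\<beta> (adding_machine n (\<beta> (?t' (pair_word n (z + 1))))) =
        adding_machine n (\<beta> (?t' (\<beta> (pair_word n (z + 1)))))"
      by (simp add: fun_eq_iff)
    moreover have "z + 1 + g (z + 1) = z + g (z + 1) + 1" by simp
    ultimately have "pair_word n (z + g z + 1 + g (z + g z + 1)) =
        pair_word n (z + g (z + 1) + g (z + g (z + 1)) + 1)"
      by (simp only: t' bg t)
    then have "[z + g z + 1 + g (z + g z + 1) = z + g (z + 1) + g (z + g (z + 1)) + 1] (mod ?N)"
      by (simp add: pair_word_eq_iff [OF b(3)])
    moreover have "g (z + g z + 1) = g (z + 1 + s)" using gg [of "z + 1" z] by (simp add: ac_simps)
    moreover have "g (z + g (z + 1)) = g (z + s)" by (rule gg)
    ultimately have "?N dvd (z + g z + 1 + g (z + 1 + s)) - (z + g (z + 1) + g (z + s) + 1)"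
      by (simp add: cong_iff_dvd_diff)
    then show ?thesis unfolding cong_iff_dvd_diff by (simp add: algebra_simps)
  qed
  define c where "c = g (z + s) - g z"
  have const: "[g (w + s) - g w = c] (mod ?N)" for w
  proof (induction w rule: int_induct [where k = z])
    case base
    then show ?case by (simp add: c_def)
  next
    case (step1 w)
    then show ?case using cong_trans [OF step [of w] step1(2)] by simp
  next
    case (step2 w)
    then show ?case using cong_trans [OF cong_sym [OF step [of "w - 1"]]] by simp
  qed
  have prog: "[g (z + int k * s) = g z + int k * c] (mod ?N)" for k
  proof (induction k)
    case (Suc k)
    have "[(g (z + int k * s + s) - g (z + int k * s)) + g (z + int k * s) = c + (g z + int k * c)] (mod ?N)"
      by (intro cong_add const Suc)
    then show ?case by (simp add: algebra_simps)
  qed simp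
  define F where "F k = z + int k * g z + c * int (k * (k - 1) div 2)" for k
  have nc: "int n dvd c"
    using cong_trans [OF gs [of "z + s"] cong_sym [OF gs [of z]]]
    by (simp add: c_def cong_iff_dvd_diff)
  have iter: "(\<beta> ^^ k) (pair_word n z) = pair_word n (F k)" for k
  proof (induction k)
    case (Suc k)
    have "[F k = z + int k * s + 0] (mod int n)"
      unfolding F_def using nc by (intro cong_add cong_mult cong_refl gs) (simp add: cong_0_iff)
    then have "g (F k) = g (z + int k * s)" by (intro per) simp
    then have "[F k + g (F k) = F k + (g z + int k * c)] (mod ?N)"
      using cong_add [OF cong_refl prog [of k]] by simp
    moreover have "F k + (g z + int k * c) = F (Suc k)"
    proof -
      have "Suc k * k div 2 = k * (k - 1) div 2 + k"
      proof -
        have "Suc k * k = k * (k - 1) + 2 * k" by (cases k) (auto simp: algebra_simps)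
        then show ?thesis by simp
      qed
      then show ?thesis by (simp add: F_def algebra_simps)
    qed
    ultimately show ?case by (simp add: Suc bg pair_word_eq_iff [OF b(3)])
  qed (simp add: F_def)
  have "?N dvd c * int (n * (n - 1) div 2)"
  proof -
    have "n * (n - 1) div 2 = n * ((n - 1) div 2)" using b(4) by (simp add: div_mult_swap)
    then show ?thesis using mult_dvd_mono [OF nc, of "int n"] by simp
  qed
  moreover have "?N dvd int n * g z - int n * s"
    using gs [of z] mult_dvd_mono [of "int n" "int n" "int n" "g z - s"]
    by (simp add: cong_iff_dvd_diff right_diff_distrib)
  ultimately have "?N dvd c * int (n * (n - 1) div 2) + (int n * g z - int n * s)"
    by (rule dvd_add)
  then have "[F n = z + int n * s] (mod ?N)"
    by (simp add: F_def cong_iff_dvd_diff algebra_simps)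
  then show ?thesis by (simp add: iter pair_word_eq_iff [OF b(3)])
qed

section \<open>Commuting with the conjugates by the adding machine forces an odometer\<close>

text \<open>
  The hypotheses, with \<open>s\<close> fixed, pass to the first return map, so coinduction applies. Coprimality
  makes the action on the first level an \<open>n\<close>-cycle.
\<close>
theorem odometerI:
  assumes "odd n" "coprime s (int n)" "\<beta> \<in> tree_auts n" "rotational n \<beta>"
    and "\<And>j. j < n \<Longrightarrow> \<beta> [j] = [nat ((int j + s) mod int n)]"
    and "conjugates_commute n \<beta>"
  shows "odometer n \<beta>"
proof -
  have n: "0 < n" using assms(1) by (cases n) auto
  define H where "H \<beta> \<longleftrightarrow> \<beta> \<in> tree_auts n \<and> rotational n \<beta> \<and>
    (\<forall>j<n. \<beta> [j] = [nat ((int j + s) mod int n)]) \<and> conjugates_commute n \<beta>" for \<beta>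
  have step: "inj_on (\<lambda>i. (\<beta> ^^ i) [0]) {..<n} \<and> (\<beta> ^^ n) [0] = [0] \<and> H (first_return n \<beta>)"
    if "H \<beta>" for \<beta>
  proof -
    have b: "\<beta> \<in> tree_auts n" "rotational n \<beta>" "conjugates_commute n \<beta>"
      and s: "\<And>j. j < n \<Longrightarrow> \<beta> [j] = [nat ((int j + s) mod int n)]"
      using that by (auto simp: H_def)
    have pow: "(\<beta> ^^ k) [0] = [nat ((int k * s) mod int n)]" for k
    proof (induction k)
      case (Suc k)
      have "nat ((int k * s) mod int n) < n" using n by (simp add: nat_less_iff)
      then show ?case using n by (simp add: Suc s mod_simps algebra_simps)
    qed simp
    have inj: "inj_on (\<lambda>i. (\<beta> ^^ i) [0]) {..<n}"
    proof (rule inj_onI)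
      fix i j assume ij: "i \<in> {..<n}" "j \<in> {..<n}" "(\<beta> ^^ i) [0] = (\<beta> ^^ j) [0]"
      then have "[int i * s = int j * s] (mod int n)"
        using n by (simp add: pow cong_def nat_eq_iff)
      then have "[int i = int j] (mod int n)" using assms(2) by (simp add: cong_mult_rcancel)
      then show "i = j" using ij by (simp add: cong_def)
    qed
    have ret: "(\<beta> ^^ n) [0] = [0]" by (simp add: pow)
    \<comment> \<open>The words below the letter \<open>0\<close> are the multiples \<open>n * j\<close>, which \<open>\<beta> ^^ n\<close> shifts by \<open>n * s\<close>.\<close>
    have "first_return n \<beta> [j] = [nat ((int j + s) mod int n)]" if j: "j < n" for j
    proof -
      have "(\<beta> ^^ n) (pair_word n (0 + int n * int j)) = pair_word n (0 + int n * (int j + s))"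
        using return_pair_word [OF b(1,2) n assms(1) s b(3), of "int n * int j"]
        by (simp add: algebra_simps)
      then have "(\<beta> ^^ n) [0, j] = [0, nat ((int j + s) mod int n)]"
        using n j by (subst (asm) (1 2) pair_word_digits) auto
      then show ?thesis by (simp add: first_return_Cons(2) [OF b(1) ret n])
    qed
    moreover have "rotational n (first_return n \<beta>)"
      unfolding first_return_def
      by (intro rotational_section rotational_funpow tree_aut_funpow b n)
    ultimately show ?thesis
      using inj ret first_return_Cons(1) [OF b(1) ret n]
        conjugates_commute_first_return [OF b(1) ret n b(3)] by (simp add: H_def)
  qed
  have "H \<beta>" using assms by (simp add: H_def)
  then show ?thesis
  proof (coinduction arbitrary: \<beta>)
    case odometer
    then show ?case using step [of \<beta>] by (auto simp: H_def)
  qed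
qed

lemma conjugates_commuteI:
  assumes b: "\<beta> \<in> tree_auts n"
    and comm: "\<forall>x::int. commutator (aut_tree n) \<beta>
           (conj_by (aut_tree n) \<beta> (adding_machine n [^]\<^bsub>aut_tree n\<^esub> x)) = \<one>\<^bsub>aut_tree n\<^esub>"
  shows "conjugates_commute n \<beta>"
  unfolding conjugates_commute_def Let_def
proof
  fix x :: nat
  interpret group "aut_tree n" by (rule group_aut_tree)
  let ?t = "adding_machine n ^^ x"
  define \<alpha> where "\<alpha> = ?t \<circ> \<beta> \<circ> inv_into UNIV ?t"
  have t: "?t \<in> tree_auts n" by (intro tree_aut_funpow adding_machine_tree_aut)
  have a: "\<alpha> \<in> carrier (aut_tree n)"
    unfolding \<alpha>_def carrier_aut_tree by (intro tree_aut_comp inv_tree_aut t b)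
  have b': "\<beta> \<in> carrier (aut_tree n)" using b by (simp add: carrier_aut_tree)
  have "conj_by (aut_tree n) \<beta> (adding_machine n [^]\<^bsub>aut_tree n\<^esub> int x) = \<alpha>"
    by (simp add: int_pow_int nat_pow_aut_tree conj_by_def mult_aut_tree inv_aut_tree t
        \<alpha>_def comp_assoc)
  then have "inv\<^bsub>aut_tree n\<^esub> \<beta> \<otimes>\<^bsub>aut_tree n\<^esub> inv\<^bsub>aut_tree n\<^esub> \<alpha> \<otimes>\<^bsub>aut_tree n\<^esub> \<beta> \<otimes>\<^bsub>aut_tree n\<^esub> \<alpha> = \<one>\<^bsub>aut_tree n\<^esub>"
    using comm [rule_format, of "int x"] by (simp add: commutator_def)
  then have "inv\<^bsub>aut_tree n\<^esub> (\<alpha> \<otimes>\<^bsub>aut_tree n\<^esub> \<beta>) \<otimes>\<^bsub>aut_tree n\<^esub> (\<beta> \<otimes>\<^bsub>aut_tree n\<^esub> \<alpha>) = \<one>\<^bsub>aut_tree n\<^esub>"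
    using a b' by (simp add: inv_mult_group m_assoc)
  then have "\<beta> \<otimes>\<^bsub>aut_tree n\<^esub> \<alpha> = \<alpha> \<otimes>\<^bsub>aut_tree n\<^esub> \<beta>"
    using a b' by (metis inv_closed inv_equality inv_inv m_closed inv_solve_left r_one)
  then show "\<beta> \<circ> (?t \<circ> \<beta> \<circ> inv_into UNIV ?t) = ?t \<circ> \<beta> \<circ> inv_into UNIV ?t \<circ> \<beta>"
    unfolding \<alpha>_def [symmetric] mult_aut_tree by simp
qed

theorem theoremC:
  fixes n :: nat and s :: int and \<beta> :: "nat list \<Rightarrow> nat list"
  assumes "n \<ge> 3" and "odd n"
    and "coprime s (int n)"
    and "\<beta> \<in> layer_closure n (generate (perm_group {..<n}) {rotation n})"
    and "activity n \<beta> = rotation n [^]\<^bsub>perm_group {..<n}\<^esub> s"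
    and "\<forall>x::int. commutator (aut_tree n) \<beta>
           (conj_by (aut_tree n) \<beta> (adding_machine n [^]\<^bsub>aut_tree n\<^esub> x)) = \<one>\<^bsub>aut_tree n\<^esub>"
  shows "conjugate_in (aut_tree n) \<beta> (adding_machine n)"
proof (rule odometer_conjugate, rule odometerI [OF assms(2,3)])
  note b = rotational_layer_closure [OF assms(4)]
  show "\<beta> \<in> tree_auts n" "rotational n \<beta>" by (fact b)+
  show "\<beta> [j] = [nat ((int j + s) mod int n)]" if "j < n" for j
    using tree_aut_singleton(1) [OF b(1) that] assms(5) rotation_int_pow [OF that] by simp
  show "conjugates_commute n \<beta>" by (rule conjugates_commuteI [OF b(1) assms(6)])
qed

end
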